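(* Let $r\ge 1$ be an integer and put $m=2^r$. For every $n\ge 0$, \[ \nu_2(t_m(n))=\nu_2\binom{n+m-1}{m-1}. \] Moreover, for every integer $s\ge 1$, the sequence \[ \bigl(\operatorname{odd}(t_m(n))\bmod 2^s\bigr)_{n\ge 0} \] is $2$-automatic.
   Context: Let $T(x)=\prod_{j\ge 0}(1-x^{2^j})\in\mathbb Z[[x]]$ be the Thue--Morse generating function, and for each integer $m\ge 1$ define the integers $t_m(n)$ by $T(x)^m=\sum_{n\ge 0}t_m(n)x^n$. For a nonzero integer $a$, $\nu_2(a)$ is the largest integer $v$ such that $2^v$ divides $a$, and $\nu_2(0)=+\infty$. The signed odd part is $\operatorname{odd}(a)=a/2^{\nu_2(a)}$ for $a\neq 0$ and $\operatorname{odd}(0)=0$. A sequence $(a_n)_{n\ge 0}$ with values in a finite set is $2$-automatic if there is a finite automaton which, reading the binary expansion of $n$ from the most significant digit, outputs $a_n$; equivalently, its $2$-kernel $\{(a_{2^e n+c})_{n\ge 0}: e\ge 0,\ 0\le c<2^e\}$ is finite. *)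

theory Defs
  imports
    "HOL-Analysis.Infinite_Products"
    "HOL-Computational_Algebra.Computational_Algebra"
    "HOL-Library.Extended_Nat"
begin

text \<open>The infinite product is taken in the \<open>X\<close>-adic metric on formal power series.\<close>

definition thue_morse_fps :: "int fps" where
  "thue_morse_fps = (\<Prod>j. 1 - fps_X ^ (2 ^ j))"

definition thue_morse_coeff :: "nat \<Rightarrow> nat \<Rightarrow> int" where
  "thue_morse_coeff m n = fps_nth (thue_morse_fps ^ m) n"

definition nu2 :: "int \<Rightarrow> enat" where
  "nu2 a = (if a = 0 then \<infinity> else enat (multiplicity 2 a))"

definition odd_part :: "int \<Rightarrow> int" where
  "odd_part a = (if a = 0 then 0 else a div 2 ^ multiplicity 2 a)"

text \<open>Most significant digit first, without leading zeros; the expansion of \<open>0\<close> is empty.\<close>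

fun binary_digits :: "nat \<Rightarrow> nat list" where
  "binary_digits n = (if n = 0 then [] else binary_digits (n div 2) @ [n mod 2])"

declare binary_digits.simps [simp del]

text \<open>The states of the automaton are taken to be natural numbers, which is no restriction
  because the state set is finite. Finiteness of the range of the sequence is then automatic.\<close>

definition two_automatic :: "(nat \<Rightarrow> 'a) \<Rightarrow> bool" where
  "two_automatic a \<longleftrightarrow>
    (\<exists>(Q :: nat set) q0 (\<delta> :: nat \<Rightarrow> nat \<Rightarrow> nat) (\<tau> :: nat \<Rightarrow> 'a).
      finite Q \<and> q0 \<in> Q \<and> (\<forall>q\<in>Q. \<forall>d\<in>{0, 1}. \<delta> q d \<in> Q) \<and>
      (\<forall>n. a n = \<tau> (foldl \<delta> q0 (binary_digits n))))"

definition two_kernel :: "(nat \<Rightarrow> 'a) \<Rightarrow> (nat \<Rightarrow> 'a) set" where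
  "two_kernel a = {\<lambda>n. a (2 ^ e * n + c) | e c. c < 2 ^ e}"


lemma fps_nth_mult_one_minus_X_power:
  fixes f :: "int fps"
  assumes "n < k"
  shows "fps_nth (f * (1 - fps_X ^ k)) n = fps_nth f n"
  using assms by (simp add: algebra_simps fps_X_power_mult_right_nth)

lemma thue_morse_partial_nth:
  fixes n N :: nat
  assumes "n \<le> N"
  shows "fps_nth (\<Prod>j\<le>N. 1 - fps_X ^ (2 ^ j) :: int fps) n =
         fps_nth (\<Prod>j\<le>n. 1 - fps_X ^ (2 ^ j)) n"
  using assms
proof (induction N rule: dec_induct)
  case (step N)
  have "n < 2 ^ Suc N"
    using step.hyps less_exp[of "Suc N"] by linarith
  then have "fps_nth (\<Prod>j\<le>Suc N. 1 - fps_X ^ (2 ^ j) :: int fps) n =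
      fps_nth (\<Prod>j\<le>N. 1 - fps_X ^ (2 ^ j)) n"
    unfolding prod.atMost_Suc by (rule fps_nth_mult_one_minus_X_power)
  with step.IH show ?case by simp
qed simp

lemma thue_morse_fps_has_prod:
  "(\<lambda>j. 1 - fps_X ^ (2 ^ j) :: int fps) has_prod thue_morse_fps"
proof -
  let ?P = "\<lambda>N. \<Prod>j\<le>N. 1 - fps_X ^ (2 ^ j) :: int fps"
  define T where "T = Abs_fps (\<lambda>n. fps_nth (?P n) n)"
  have lim: "?P \<longlonglongrightarrow> T"
  proof (rule metric_LIMSEQ_I)
    fix r :: real assume "r > 0"
    then obtain n0 where n0: "(1/2) ^ n0 < r"
      using real_arch_pow_inv[of r "1/2"] by auto
    have "dist (?P N) T < r" if "N \<ge> n0" for N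
    proof (cases "?P N = T")
      case False
      have "fps_nth (?P N - T) i = 0" if "i \<le> N" for i
        using thue_morse_partial_nth[OF that] by (simp add: T_def)
      then have "subdegree (?P N - T) > N"
        using False by (intro subdegree_greaterI) auto
      then have "inverse (2 ^ subdegree (?P N - T)) \<le> ((1/2) ^ n0 :: real)"
        using \<open>N \<ge> n0\<close> by (simp add: power_one_over inverse_eq_divide field_simps)
      with n0 False show ?thesis by (simp add: dist_fps_def)
    qed (use \<open>r > 0\<close> in simp)
    then show "\<exists>n0. \<forall>N\<ge>n0. dist (?P N) T < r" by blast
  qed
  have "fps_nth T 0 = 1" by (simp add: T_def)
  then have "T \<noteq> 0" by auto
  with lim have "(\<lambda>j. 1 - fps_X ^ (2 ^ j) :: int fps) has_prod T"
    by (simp add: has_prod_def raw_has_prod_def)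
  then show ?thesis
    unfolding thue_morse_fps_def using has_prod_unique by fastforce
qed

lemma foldl_binary_digits:
  assumes "\<And>n d. d < 2 \<Longrightarrow> g (2 * n + d) = \<delta> (g n) d"
  shows "foldl \<delta> (g 0) (binary_digits n) = g n"
proof (induction n rule: less_induct)
  case (less n)
  show ?case
  proof (cases "n = 0")
    case False
    then have "foldl \<delta> (g 0) (binary_digits n) = \<delta> (g (n div 2)) (n mod 2)"
      using less.IH[of "n div 2"] by (subst binary_digits.simps) simp
    also have "\<dots> = g n"
      using assms[of "n mod 2" "n div 2"] by simp
    finally show ?thesis .
  qed (simp add: binary_digits.simps)
qed

lemma two_kernel_step:
  assumes "b \<in> two_kernel a" "d < 2"
  shows "(\<lambda>n. b (2 * n + d)) \<in> two_kernel a"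
proof -
  obtain e c where b: "b = (\<lambda>n. a (2 ^ e * n + c))" and c: "c < 2 ^ e"
    using assms(1) by (auto simp: two_kernel_def)
  have eq: "(\<lambda>n. b (2 * n + d)) = (\<lambda>n. a (2 ^ Suc e * n + (2 ^ e * d + c)))"
    by (simp add: b algebra_simps)
  have "2 ^ e * d + c < 2 ^ Suc e"
  proof (cases "d = 0")
    case False
    with assms(2) have "d = 1" by simp
    with c show ?thesis by simp
  qed (use c in simp)
  with eq show ?thesis unfolding two_kernel_def by blast
qed

lemma two_automatic_if_finite_two_kernel:
  assumes "finite (two_kernel a)" "finite (range a)"
  shows "two_automatic a"
proof -
  let ?K = "two_kernel a"
  define g where "g = (\<lambda>n. restrict (\<lambda>b. b n) ?K)"
  have a_K: "a \<in> ?K"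
    by (auto simp: two_kernel_def intro!: exI[of _ "0::nat"])
  have "range g \<subseteq> (\<Pi>\<^sub>E b\<in>?K. range a)"
    unfolding g_def by (intro image_subsetI restrict_PiE_iff[THEN iffD2]) (auto simp: two_kernel_def)
  then have fin: "finite (range g)"
    using finite_PiE[of ?K "\<lambda>_. range a"] assms finite_subset by blast
  then obtain h :: "_ \<Rightarrow> nat" where h: "inj_on h (range g)"
    using finite_imp_inj_to_nat_seg by metis
  define r where "r q = (SOME n. h (g n) = q)" for q
  have r: "g (r (h (g n))) = g n" for n
  proof -
    have "h (g (r (h (g n)))) = h (g n)"
      unfolding r_def by (rule someI[of _ n]) simp
    then show ?thesis using h by (auto dest: inj_onD)
  qed
  define \<delta> where "\<delta> q d = h (g (2 * r q + d))" for q d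
  have step: "g (2 * m + d) = g (2 * n + d)" if "g m = g n" "d < 2" for m n d
  proof -
    have "b (2 * m + d) = b (2 * n + d)" if "b \<in> ?K" for b
      using two_kernel_step[OF that \<open>d < 2\<close>] fun_cong[OF \<open>g m = g n\<close>, of "\<lambda>k. b (2 * k + d)"]
      by (simp add: g_def)
    then show ?thesis
      unfolding g_def by (intro restrict_ext)
  qed
  have run: "foldl \<delta> (h (g 0)) (binary_digits n) = h (g n)" for n
    by (rule foldl_binary_digits) (auto simp: \<delta>_def intro!: arg_cong[of _ _ h] step r[symmetric])
  have out: "g (r (h (g n))) a = a n" for n
    using a_K by (simp add: r) (simp add: g_def)
  show ?thesis
    unfolding two_automatic_def
    by (rule exI[of _ "h ` range g"], rule exI[of _ "h (g 0)"], rule exI[of _ \<delta>],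
        rule exI[of _ "\<lambda>q. g (r q) a"]) (use fin in \<open>auto simp: run out \<delta>_def\<close>)
qed

end

theory Submission
  imports Defs
begin

text \<open>With \<open>m = 2 ^ r\<close>, both \<open>T(x)\<close> and \<open>G(x) = 1 / (1 - x)\<close> satisfy a dilation equation
  \<open>F(x) = (1 + c x) F(x\<^sup>2)\<close>, with \<open>c = -1\<close> and \<open>c = 1\<close>. Hence the coefficients of \<open>T ^ m\<close> and those
  of \<open>G ^ m\<close>, which are the binomial coefficients of the theorem, obey the same recurrence up to
  sign. Every term of the recurrence is divisible by the power of 2 expected at the left-hand side,
  so the normalised sequences obey recurrences with the same integer weights up to sign, and modulo 2
  they agree. The weights are periodic where the valuation is unbounded; elsewhere the odd part can
  be read off from the coefficient modulo a fixed power of 2. This bounds the number of states.\<close>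

section \<open>Dilation equations of the two power series\<close>

lemma fps_nth_compose_X_squared:
  fixes f :: "'a::comm_ring_1 fps"
  shows "fps_nth (f oo fps_X ^ 2) n = (if even n then fps_nth f (n div 2) else 0)"
proof -
  have "fps_nth (f oo fps_X ^ 2) n = (\<Sum>i=0..n. if n = 2 * i then fps_nth f i else 0)"
    unfolding fps_compose_nth power_mult[symmetric] fps_X_power_nth
    by (rule sum.cong) auto
  also have "\<dots> = (if even n then fps_nth f (n div 2) else 0)"
  proof (cases "even n")
    case True
    then obtain k where "n = 2 * k" by blast
    then show ?thesis by (simp add: sum.delta)
  next
    case False
    then show ?thesis by (auto intro!: sum.neutral)
  qed
  finally show ?thesis .
qed

lemma fps_nth_one_plus_const_X_power:
  fixes c :: "'a::comm_ring_1"
  shows "fps_nth ((1 + fps_const c * fps_X) ^ m) j = of_nat (m choose j) * c ^ j"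
proof -
  have "(1 + fps_const c * fps_X) ^ m =
      (\<Sum>k\<le>m. fps_const (of_nat (m choose k) * c ^ k) * fps_X ^ k)"
    by (subst add.commute, subst binomial_ring)
      (simp add: power_mult_distrib fps_const_power fps_of_nat[symmetric] mult.assoc
        flip: fps_const_mult)
  then have "fps_nth ((1 + fps_const c * fps_X) ^ m) j =
      (\<Sum>k\<le>m. if k = j then of_nat (m choose k) * c ^ k else 0)"
    by (simp add: fps_sum_nth fps_X_power_nth if_distrib eq_commute cong: if_cong)
  then show ?thesis by (simp add: binomial_eq_0)
qed

text \<open>Convergence in the X-adic metric makes each coefficient eventually constant, and by
  \<open>thue_morse_partial_nth\<close> it is constant once the product has reached n.\<close>

lemma thue_morse_fps_nth:
  assumes "n \<le> N"
  shows "fps_nth thue_morse_fps n = fps_nth (\<Prod>j\<le>N. 1 - fps_X ^ (2 ^ j)) n"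
proof -
  let ?P = "\<lambda>N. \<Prod>j\<le>N. 1 - fps_X ^ (2 ^ j) :: int fps"
  have "?P \<longlonglongrightarrow> thue_morse_fps"
    by (rule has_prod_imp_tendsto[OF thue_morse_fps_has_prod])
  then have "\<forall>\<^sub>F M in sequentially. fps_nth (?P M) n = fps_nth thue_morse_fps n"
    by (simp add: tendsto_fps_iff)
  then obtain K where K: "\<And>M. M \<ge> K \<Longrightarrow> fps_nth (?P M) n = fps_nth thue_morse_fps n"
    unfolding eventually_sequentially by blast
  show ?thesis
    using K[of "max K n"] thue_morse_partial_nth[of n "max K n"] thue_morse_partial_nth[OF assms]
    by simp
qed

text \<open>Splitting off the factor j = 0 of a partial product leaves the previous partial product
  in x^2. Partial products suffice since a single coefficient involves only finitely many
  factors.\<close>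

lemma thue_morse_fps_dilation:
  "thue_morse_fps = (1 - fps_X) * (thue_morse_fps oo fps_X ^ 2)"
proof (rule fps_ext)
  fix n :: nat
  let ?P = "\<lambda>N. \<Prod>j\<le>N. 1 - fps_X ^ (2 ^ j) :: int fps"
  have "?P (Suc n) = (1 - fps_X) * (\<Prod>j\<le>n. 1 - fps_X ^ (2 ^ Suc j))"
    by (subst prod.atMost_Suc_shift) simp
  also have "(\<Prod>j\<le>n. 1 - fps_X ^ (2 ^ Suc j)) = (?P n oo fps_X ^ 2)"
    by (simp add: fps_compose_prod_distrib fps_compose_sub_distrib fps_X_power_compose
        flip: power_mult)
  finally have "fps_nth thue_morse_fps n = fps_nth ((1 - fps_X) * (?P n oo fps_X ^ 2)) n"
    using thue_morse_fps_nth[of n "Suc n"] by simp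
  also have "\<dots> = fps_nth ((1 - fps_X) * (thue_morse_fps oo fps_X ^ 2)) n"
    unfolding fps_mult_nth fps_nth_compose_X_squared
    by (intro sum.cong refl) (auto simp: thue_morse_fps_nth[of _ n])
  finally show "fps_nth thue_morse_fps n =
      fps_nth ((1 - fps_X) * (thue_morse_fps oo fps_X ^ 2)) n" .
qed

text \<open>In closed form this is 1 / (1 - x) = (1 + x) / (1 - x^2).\<close>

lemma geometric_fps_dilation:
  fixes G :: "int fps"
  defines "G \<equiv> Abs_fps (\<lambda>_. 1)"
  shows "G = (1 + fps_X) * (G oo fps_X ^ 2)"
proof (rule fps_ext)
  fix n
  show "fps_nth G n = fps_nth ((1 + fps_X) * (G oo fps_X ^ 2)) n"
    by (simp add: distrib_right fps_nth_compose_X_squared G_def)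
qed

text \<open>Multiplying by the geometric series forms partial sums, which the hockey-stick identity
  evaluates.\<close>

lemma geometric_fps_power_nth:
  "fps_nth (Abs_fps (\<lambda>_. 1 :: int) ^ Suc k) n = int ((n + k) choose k)"
proof (induction k arbitrary: n)
  case (Suc k)
  have "fps_nth (Abs_fps (\<lambda>_. 1 :: int) ^ Suc (Suc k)) n = (\<Sum>i=0..n. int ((i + k) choose k))"
    by (subst power_Suc2) (simp add: fps_mult_nth Suc.IH del: power_Suc)
  also have "\<dots> = int (\<Sum>i\<le>n. (k + i) choose k)"
    by (simp add: atMost_atLeast0 add.commute)
  finally show ?case
    by (simp only: choose_rising_sum(1)) (simp add: add.commute)
qed simp

section \<open>The recurrence for the coefficients of a power\<close>

text \<open>Coefficient form of F(x)^m = (1 + c x)^m F(x^2)^m, meant for c * c = 1: since j has the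
  parity of N, the factor c^j is common to all terms and moves in front of the sum. Integer indices
  avoid boundary terms.\<close>

definition dilation_recurrence :: "nat \<Rightarrow> int \<Rightarrow> (int \<Rightarrow> int) \<Rightarrow> bool" where
  "dilation_recurrence m c f \<longleftrightarrow> (\<forall>N. f N = (if even N then 1 else c) *
     (\<Sum>j | j \<le> m \<and> even (N - int j). int (m choose j) * f ((N - int j) div 2)))"

definition int_coeff :: "int fps \<Rightarrow> int \<Rightarrow> int" where
  "int_coeff F k = (if k < 0 then 0 else fps_nth F (nat k))"

lemma dilation_recurrence_power:
  fixes F :: "int fps"
  assumes F: "F = (1 + fps_const c * fps_X) * (F oo fps_X ^ 2)" and c: "c * c = 1"
  shows "dilation_recurrence m c (int_coeff (F ^ m))"
  unfolding dilation_recurrence_def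
proof
  fix N :: int
  let ?f = "int_coeff (F ^ m)"
  let ?J = "{j. j \<le> m \<and> even (N - int j)}"
  show "?f N = (if even N then 1 else c) *
     (\<Sum>j\<in>?J. int (m choose j) * ?f ((N - int j) div 2))"
  proof (cases "N < 0")
    case True
    then have "(\<Sum>j\<in>?J. int (m choose j) * ?f ((N - int j) div 2)) = 0"
      by (intro sum.neutral) (auto simp: int_coeff_def)
    with True show ?thesis by (simp add: int_coeff_def)
  next
    case False
    then obtain n where N: "N = int n" by (metis nonneg_int_cases not_less)
    have cp: "c ^ j = (if even j then 1 else c)" for j
      using c by (auto elim!: evenE oddE simp: power_mult power2_eq_square)
    have "F ^ m = ((1 + fps_const c * fps_X) * (F oo fps_X ^ 2)) ^ m"
      by (rule arg_cong[OF F])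
    also have "\<dots> = (1 + fps_const c * fps_X) ^ m * (F ^ m oo fps_X ^ 2)"
      by (simp add: power_mult_distrib fps_compose_power)
    finally have "fps_nth (F ^ m) n = fps_nth ((1 + fps_const c * fps_X) ^ m * (F ^ m oo fps_X ^ 2)) n"
      by (rule arg_cong)
    also have "\<dots> = (\<Sum>j=0..n. (int (m choose j) * c ^ j) *
        (if even (n - j) then fps_nth (F ^ m) ((n - j) div 2) else 0))"
      unfolding fps_mult_nth fps_nth_compose_X_squared fps_nth_one_plus_const_X_power ..
    \<comment> \<open>The range j <= n is traded for j <= m: \<open>m choose j\<close> vanishes for
      j > m, and for j > n the halved index is negative, where \<open>int_coeff\<close> is
      0.\<close>
    also have "\<dots> = (\<Sum>j=0..n. if j \<in> ?J then
        c ^ n * (int (m choose j) * ?f ((N - int j) div 2)) else 0)"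
    proof (rule sum.cong[OF refl])
      fix j assume "j \<in> {0..n}"
      then have j: "j \<le> n" by simp
      then have eq: "N - int j = int (n - j)" by (simp add: N)
      have d: "(int (n - j)) div 2 = int ((n - j) div 2)" by simp
      have "c ^ j = c ^ n" if "even (n - j)"
        using that j by (simp add: cp)
      then show "int (m choose j) * c ^ j *
          (if even (n - j) then fps_nth (F ^ m) ((n - j) div 2) else 0) =
          (if j \<in> ?J then c ^ n * (int (m choose j) * ?f ((N - int j) div 2)) else 0)"
        unfolding mem_Collect_eq eq d
        by (auto simp: int_coeff_def binomial_eq_0)
    qed
    also have "\<dots> = (\<Sum>j \<in> ?J \<inter> {0..n}. c ^ n * (int (m choose j) * ?f ((N - int j) div 2)))"
      by (simp add: sum.inter_restrict Int_commute)
    also have "\<dots> = (\<Sum>j \<in> ?J. c ^ n * (int (m choose j) * ?f ((N - int j) div 2)))"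
      by (rule sum.mono_neutral_left) (auto simp: int_coeff_def N)
    also have "\<dots> = c ^ n * (\<Sum>j \<in> ?J. int (m choose j) * ?f ((N - int j) div 2))"
      by (simp add: sum_distrib_left)
    finally show ?thesis
      by (simp add: cp N int_coeff_def)
  qed
qed

section \<open>Valuations of the binomial coefficients\<close>

text \<open>By Kummer's theorem, \<open>binomial_val r k\<close> counts the carries when \<open>k\<close> and \<open>2 ^ r - 1\<close> are
  added in base 2: \<open>residue_val\<close> those inside the last \<open>r\<close> digits, \<open>block_val\<close> the later ones. For
  \<open>- 2 ^ r < k < 0\<close> the true valuation is infinite, but \<open>block_val r k = multiplicity 2 0 = 0\<close>.\<close>

definition residue_val :: "nat \<Rightarrow> int \<Rightarrow> nat" where
  "residue_val r k = (if 2 ^ r dvd k then 0 else r - multiplicity 2 k)"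

definition block_val :: "nat \<Rightarrow> int \<Rightarrow> nat" where
  "block_val r k = (if 2 ^ r dvd k then 0 else multiplicity 2 (k div 2 ^ r + 1))"

definition binomial_val :: "nat \<Rightarrow> int \<Rightarrow> nat" where
  "binomial_val r k = residue_val r k + block_val r k"

lemma power2_dvd_iff_le_multiplicity:
  fixes k :: int
  assumes "k \<noteq> 0"
  shows "2 ^ n dvd k \<longleftrightarrow> n \<le> multiplicity 2 k"
  using assms by (intro power_dvd_iff_le_multiplicity) auto

lemma multiplicity_less_if_not_power2_dvd:
  fixes k :: int
  assumes "\<not> 2 ^ r dvd k"
  shows "multiplicity 2 k < r"
  using assms by (cases "k = 0") (auto simp: power2_dvd_iff_le_multiplicity)

lemma multiplicity_2_mult:
  fixes a b :: int
  assumes "a \<noteq> 0" "b \<noteq> 0"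
  shows "multiplicity 2 (a * b) = multiplicity 2 a + multiplicity 2 b"
  using assms by (intro prime_elem_multiplicity_mult_distrib) auto

lemma multiplicity_power2_mult:
  fixes k :: int
  assumes "k \<noteq> 0"
  shows "multiplicity 2 (2 ^ r * k) = r + multiplicity 2 k"
  using assms by (simp add: multiplicity_2_mult multiplicity_same_power)

text \<open>Divisibility by 2^n with n <= r sees only residues modulo 2^r, and both valuations are
  below r.\<close>

lemma multiplicity_cong_power2:
  fixes a b :: int
  assumes "a mod 2 ^ r = b mod 2 ^ r" and "\<not> 2 ^ r dvd a"
  shows "multiplicity 2 a = multiplicity 2 b"
proof -
  have nb: "\<not> 2 ^ r dvd b" using assms by (simp add: dvd_eq_mod_eq_0)
  have nz: "a \<noteq> 0" "b \<noteq> 0" using assms(2) nb by auto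
  have "2 ^ n dvd a \<longleftrightarrow> 2 ^ n dvd b" if "n \<le> r" for n
    using assms(1) that by (metis dvd_mod_iff le_imp_power_dvd)
  then have *: "n \<le> multiplicity 2 a \<longleftrightarrow> n \<le> multiplicity 2 b" if "n \<le> r" for n
    using that nz by (simp add: power2_dvd_iff_le_multiplicity)
  show ?thesis
    using *[of "multiplicity 2 a"] *[of "multiplicity 2 b"]
      multiplicity_less_if_not_power2_dvd[OF assms(2)] multiplicity_less_if_not_power2_dvd[OF nb]
    by simp
qed

lemma div_power2_add_one:
  fixes N M :: int
  assumes "M > 0" "\<not> M dvd N + 1"
  shows "(N + 1) div M = N div M"
proof -
  have "(N + 1) mod M \<noteq> 0" using assms by (simp add: dvd_eq_mod_eq_0)
  then have "(N + 1) mod M = N mod M + 1"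
    using assms(1) by (smt (verit) mod_add_left_eq mod_pos_pos_trivial mod_self
        pos_mod_bound pos_mod_sign)
  moreover have "N + 1 = M * ((N + 1) div M) + (N + 1) mod M" "N = M * (N div M) + N mod M"
    by simp_all
  ultimately have "M * ((N + 1) div M) = M * (N div M)" by linarith
  with assms(1) show ?thesis by simp
qed

text \<open>Induction on n through the ratio of consecutive coefficients, (n + 1) b(n + 1) = (n +
  2^r) b(n). The cases are: 2^r divides n + 1, it divides n, or it divides neither.\<close>

lemma multiplicity_binomial:
  assumes "r \<ge> 1"
  shows "multiplicity 2 (int ((n + (2 ^ r - 1)) choose (2 ^ r - 1))) = binomial_val r (int n)"
proof (induction n)
  case 0
  then show ?case by (simp add: binomial_val_def residue_val_def block_val_def)
next
  case (Suc n)
  let ?b = "\<lambda>n. int ((n + (2 ^ r - 1)) choose (2 ^ r - 1))"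
  define N where "N = int n"
  define M :: int where "M = 2 ^ r"
  have M: "M > 0" "even M" "M \<ge> 2"
    using assms by (auto simp: M_def self_le_power)
  have N0: "N \<ge> 0" by (simp add: N_def)
  have Mnat: "int (2 ^ r - 1) = M - 1" by (simp add: M_def of_nat_diff)
  have "Suc n * (Suc n + (2 ^ r - 1) choose (2 ^ r - 1)) =
      (Suc n + (2 ^ r - 1)) * (n + (2 ^ r - 1) choose (2 ^ r - 1))"
    using binomial_absorb_comp[of "Suc n + (2 ^ r - 1)" "2 ^ r - 1"] by simp
  from arg_cong[OF this, of int]
  have "(N + 1) * ?b (Suc n) = (N + M) * ?b n"
    unfolding of_nat_mult of_nat_add Mnat by (simp add: N_def algebra_simps)
  moreover have "?b n \<noteq> 0" "?b (Suc n) \<noteq> 0" by (simp_all add: binomial_eq_0_iff)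
  ultimately have 1: "multiplicity 2 (N + 1) + multiplicity 2 (?b (Suc n)) =
      multiplicity 2 (N + M) + binomial_val r N"
    using N0 M Suc.IH by (metis N_def multiplicity_2_mult add_nonneg_pos less_numeral_extra(3)
        zero_less_one)
  have "multiplicity 2 (N + 1) + binomial_val r (N + 1) =
      multiplicity 2 (N + M) + binomial_val r N"
  proof (cases "M dvd N + 1")
    case True
    then obtain Q where Q: "N + 1 = M * Q" by blast
    then have "Q > 0" using N0 M(1) by (smt (verit) zero_less_mult_iff)
    have NQ: "N = (M - 1) + (Q - 1) * M" using Q by (simp add: algebra_simps)
    have "N div M = Q - 1"
      unfolding NQ using M by (subst div_mult_self1) auto
    moreover have odd: "odd N" "odd (N + M)"
      using Q M(2) by (metis even_add even_mult_iff odd_one)+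
    moreover have "\<not> M dvd N" using odd(1) M(2) by (meson dvd_trans)
    moreover have "multiplicity 2 (N + 1) = r + multiplicity 2 Q"
      using Q \<open>Q > 0\<close> by (simp add: M_def multiplicity_power2_mult)
    ultimately show ?thesis
      using True by (simp add: binomial_val_def residue_val_def block_val_def M_def
          not_dvd_imp_multiplicity_0)
  next
    case ndvd: False
    have d1: "(N + 1) div M = N div M"
      using M(1) ndvd by (rule div_power2_add_one)
    have lt: "multiplicity 2 (N + 1) < r"
      using ndvd by (intro multiplicity_less_if_not_power2_dvd) (simp add: M_def)
    show ?thesis
    proof (cases "M dvd N")
      case True
      then obtain q where q: "N = M * q" by blast
      then have "q \<ge> 0" using N0 M(1) by (simp add: zero_le_mult_iff)
      have "multiplicity 2 (N + M) = r + multiplicity 2 (q + 1)"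
        using multiplicity_power2_mult[of "q + 1" r] q \<open>q \<ge> 0\<close> by (simp add: M_def algebra_simps)
      then show ?thesis
        using True ndvd d1 lt M q by (simp add: binomial_val_def residue_val_def block_val_def
            flip: M_def)
    next
      case False
      have "multiplicity 2 (N + M) = multiplicity 2 N"
        using False by (intro multiplicity_cong_power2[of _ r]) (auto simp: M_def)
      moreover have "multiplicity 2 N < r"
        using False by (intro multiplicity_less_if_not_power2_dvd) (simp add: M_def)
      ultimately show ?thesis
        using False ndvd d1 lt by (simp add: binomial_val_def residue_val_def block_val_def
            flip: M_def)
    qed
  qed
  with 1 show ?case by (simp add: N_def add.commute)
qed

section \<open>The expected valuation under halving of the index\<close>

text \<open>Absorption: j * (2^r choose j) = 2^r * ((2^r - 1) choose (j - 1)).\<close>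

lemma multiplicity_binomial_power2_ge:
  assumes "0 < j" "j \<le> 2 ^ r"
  shows "r \<le> multiplicity 2 (int j) + multiplicity 2 (int (2 ^ r choose j))"
proof -
  have "int j * int (2 ^ r choose j) = 2 ^ r * int ((2 ^ r - 1) choose (j - 1))"
    using times_binomial_minus1_eq[of j "2 ^ r"] assms(1)
    by (metis of_nat_mult of_nat_numeral of_nat_power)
  moreover have nz: "int j \<noteq> 0" "int (2 ^ r choose j) \<noteq> 0" "int ((2 ^ r - 1) choose (j - 1)) \<noteq> 0"
    using assms by (auto simp: binomial_eq_0_iff)
  ultimately have "multiplicity 2 (int j) + multiplicity 2 (int (2 ^ r choose j)) =
      r + multiplicity 2 (int ((2 ^ r - 1) choose (j - 1)))"
    by (metis multiplicity_2_mult multiplicity_power2_mult)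
  then show ?thesis by simp
qed

text \<open>Either N is a multiple of 2^r, or its block number N div 2^r is even, so that its
  successor is odd.\<close>

lemma block_val_eq_0:
  assumes "N mod (2 * 2 ^ r) \<le> 2 ^ r"
  shows "block_val r N = 0"
proof (cases "2 ^ r dvd N")
  case False
  let ?M = "2 ^ r :: int"
  define R where "R = N mod (2 * ?M)"
  have N: "N = R + (2 * (N div (2 * ?M))) * ?M"
    using div_mult_mod_eq[of N "2 * ?M"] by (simp add: R_def algebra_simps)
  have "R \<noteq> ?M"
    using N False by (metis dvd_add_times_triv_right_iff dvd_refl)
  then have "0 \<le> R" "R < ?M" using assms by (auto simp: R_def)
  then have "N div ?M = 2 * (N div (2 * ?M))"
    by (subst N, subst div_mult_self1) auto
  then show ?thesis by (simp add: block_val_def not_dvd_imp_multiplicity_0)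
qed (simp add: block_val_def)

text \<open>Here N = 2 * k + j lies strictly inside a block of odd number 2 * q + 1, which forces k
  strictly inside block q. The successors of the block numbers are 2 * (q + 1) and q + 1.\<close>

lemma block_val_halving:
  assumes "2 ^ r < (2 * k + j) mod (2 * 2 ^ r)" and "0 \<le> j" "j \<le> 2 ^ r" and "k \<ge> 0"
  shows "\<not> 2 ^ r dvd 2 * k + j" "\<not> 2 ^ r dvd k"
    and "block_val r (2 * k + j) = Suc (block_val r k)"
proof -
  let ?M = "2 ^ r :: int"
  define N where "N = 2 * k + j"
  define q where "q = N div (2 * ?M)"
  define R where "R = N mod (2 * ?M) - ?M"
  have N: "N = R + (2 * q + 1) * ?M"
    using div_mult_mod_eq[of N "2 * ?M"] by (simp add: R_def q_def algebra_simps)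
  have "N mod (2 * ?M) < 2 * ?M" by simp
  then have R: "0 < R" "R < ?M" using assms(1) by (auto simp: R_def N_def)
  have NM: "N mod ?M = R" "N div ?M = 2 * q + 1"
    using R by (subst N, simp)+
  define S where "S = k - q * ?M"
  have k: "k = S + q * ?M" by (simp add: S_def)
  have "2 * S = R + ?M - j" using N by (simp add: S_def N_def algebra_simps)
  then have S: "0 < S" "S < ?M" using R assms(2,3) by auto
  have kM: "k mod ?M = S" "k div ?M = q"
    using S by (subst k, simp)+
  show nd: "\<not> ?M dvd 2 * k + j" "\<not> ?M dvd k"
    using NM kM R S by (auto simp: dvd_eq_mod_eq_0 N_def)
  \<comment> \<open>This excludes q = -1, where \<open>multiplicity 2 0 = 0\<close> would break the
    doubling rule.\<close>
  have "q \<ge> 0" using kM assms(4) by (metis pos_imp_zdiv_nonneg_iff zero_less_numeral zero_less_power)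
  then have "multiplicity 2 (2 * (q + 1)) = Suc (multiplicity 2 (q + 1))"
    using multiplicity_power2_mult[of "q + 1" 1] by simp
  moreover have "N div ?M + 1 = 2 * (q + 1)" using NM by simp
  ultimately show "block_val r (2 * k + j) = Suc (block_val r k)"
    using nd kM(2) unfolding block_val_def N_def[symmetric] by presburger
qed

lemma multiplicity_2_add_ge_min:
  fixes a b :: int
  assumes "a \<noteq> 0" "b \<noteq> 0" "a + b \<noteq> 0"
  shows "min (multiplicity 2 a) (multiplicity 2 b) \<le> multiplicity 2 (a + b)"
  using assms by (simp add: dvd_add multiplicity_dvd' flip: power2_dvd_iff_le_multiplicity)

text \<open>This makes each term of the recurrence at N = 2 * k + j divisible by the power of 2
  expected at N. The block part grows by at most one, and only when the residue part of k is
  positive and can absorb this.\<close>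

lemma binomial_val_halving_le:
  assumes "j \<le> 2 ^ r" and "k \<ge> 0"
  shows "binomial_val r (2 * k + int j) \<le>
    binomial_val r k + multiplicity 2 (int (2 ^ r choose j))"
proof (cases "2 ^ r dvd 2 * k + int j")
  case False
  let ?M = "2 ^ r :: int" and ?N = "2 * k + int j"
  let ?C = "multiplicity 2 (int (2 ^ r choose j))"
  have j: "0 \<le> int j" "int j \<le> ?M" 
    using of_nat_mono[OF assms(1), where ?'a = int] by simp_all
  have Nlt: "multiplicity 2 ?N < r"
    using False by (rule multiplicity_less_if_not_power2_dvd)
  have vN: "binomial_val r ?N = r - multiplicity 2 ?N + block_val r ?N"
    using False by (simp add: binomial_val_def residue_val_def)
  have block: "block_val r ?N = 0 \<or> \<not> ?M dvd k \<and> block_val r ?N = Suc (block_val r k)"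
    using block_val_eq_0[of ?N r] block_val_halving[of r k "int j"] j assms(2) by linarith
  show ?thesis
  proof (cases "j = 0")
    case True
    with False have nd: "\<not> ?M dvd k" by auto
    then have "k \<noteq> 0" by auto
    then have "multiplicity 2 ?N = Suc (multiplicity 2 k)"
      using multiplicity_power2_mult[of k 1] True by simp
    then show ?thesis
      using vN Nlt block nd by (auto simp: binomial_val_def residue_val_def)
  next
    case jpos: False
    then have C: "r \<le> multiplicity 2 (int j) + ?C"
      using assms(1) by (intro multiplicity_binomial_power2_ge) auto
    have jr: "multiplicity 2 (int j) \<le> r"
    proof -
      have "2 ^ multiplicity 2 (int j) dvd int j" by (rule multiplicity_dvd)
      then have "2 ^ multiplicity 2 (int j) \<le> ?M"
        using zdvd_imp_le[of _ "int j"] jpos j(2) by (meson of_nat_0_less_iff order_trans zero_less_iff_neq_zero)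
      then show ?thesis by simp
    qed
    show ?thesis
    proof (cases "?M dvd k")
      case True
      have "2 ^ multiplicity 2 (int j) dvd ?N"
        using True jr by (intro dvd_add dvd_mult multiplicity_dvd) (meson dvd_trans le_imp_power_dvd)
      then have "multiplicity 2 (int j) \<le> multiplicity 2 ?N"
        using False by (subst (asm) power2_dvd_iff_le_multiplicity) auto
      then show ?thesis using vN block True C by auto
    next
      case nd: False
      then have k0: "k \<noteq> 0" by auto
      have kr: "multiplicity 2 k < r" using nd by (rule multiplicity_less_if_not_power2_dvd)
      have "multiplicity 2 (2 * k) = Suc (multiplicity 2 k)"
        using multiplicity_power2_mult[of k 1] k0 by simp
      moreover have "min (multiplicity 2 (2 * k)) (multiplicity 2 (int j)) \<le> multiplicity 2 ?N"
        using k0 jpos assms(2) by (intro multiplicity_2_add_ge_min) auto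
      moreover have "binomial_val r k = r - multiplicity 2 k + block_val r k"
        using nd by (simp add: binomial_val_def residue_val_def)
      \<comment> \<open>If the valuation of N is at least that of 2 * k, the residue part drops by
        one. If it is at least that of j, then \<open>C\<close> bounds the residue part of N, and
        \<open>residue_val r k\<close> is at least 1.\<close>
      ultimately show ?thesis using vN block kr jr C Nlt by linarith
    qed
  qed
qed (simp add: binomial_val_def residue_val_def block_val_def)

section \<open>Odd parts and the normalised recurrence\<close>

lemma odd_part_decompose: "a = 2 ^ multiplicity 2 a * odd_part a"
  by (simp add: odd_part_def multiplicity_dvd)

lemma odd_odd_part: "a \<noteq> 0 \<Longrightarrow> odd (odd_part a)"
  using multiplicity_decompose[of a 2] by (simp add: odd_part_def)

definition has_binomial_val :: "nat \<Rightarrow> (int \<Rightarrow> int) \<Rightarrow> int \<Rightarrow> bool" where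
  "has_binomial_val r f k \<longleftrightarrow> (if k < 0 then f k = 0
     else f k \<noteq> 0 \<and> multiplicity 2 (f k) = binomial_val r k)"

lemma has_binomial_valD:
  assumes "has_binomial_val r f k"
  shows "f k = 2 ^ binomial_val r k * odd_part (f k)"
    and "odd (odd_part (f k)) \<longleftrightarrow> k \<ge> 0"
  using assms odd_part_decompose[of "f k"] odd_odd_part[of "f k"]
  by (auto simp: has_binomial_val_def odd_part_def split: if_splits)

text \<open>By \<open>binomial_val_halving_le\<close> the division in a weight is exact when the
  halved index is nonnegative; at negative indices both sides vanish. Valuations are assumed at
  halved indices only, so this can be used in an induction to find the one at N.\<close>

lemma dilation_recurrence_odd_part:
  assumes rec: "dilation_recurrence (2 ^ r) c f"
    and val: "\<And>j. j \<le> 2 ^ r \<Longrightarrow> even (N - int j) \<Longrightarrow> has_binomial_val r f ((N - int j) div 2)"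
  shows "f N = 2 ^ binomial_val r N * ((if even N then 1 else c) *
    (\<Sum>j | j \<le> 2 ^ r \<and> even (N - int j).
      (int (2 ^ r choose j) * 2 ^ binomial_val r ((N - int j) div 2) div 2 ^ binomial_val r N) *
      odd_part (f ((N - int j) div 2))))"
proof -
  let ?J = "{j. j \<le> 2 ^ r \<and> even (N - int j)}" and ?k = "\<lambda>j. (N - int j) div 2"
  have "int (2 ^ r choose j) * f (?k j) = 2 ^ binomial_val r N *
      ((int (2 ^ r choose j) * 2 ^ binomial_val r (?k j) div 2 ^ binomial_val r N) *
        odd_part (f (?k j)))" if j: "j \<in> ?J" for j
  proof (cases "?k j < 0")
    case True
    then show ?thesis using val[of j] j by (simp add: has_binomial_val_def odd_part_def)
  next
    case False
    have N: "N = 2 * ?k j + int j" using j by simp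
    have nz: "int (2 ^ r choose j) \<noteq> 0" using j by (simp add: binomial_eq_0_iff)
    have "binomial_val r N \<le> binomial_val r (?k j) + multiplicity 2 (int (2 ^ r choose j))"
      using binomial_val_halving_le[of j r "?k j"] False j N by simp
    also have "\<dots> = multiplicity 2 (int (2 ^ r choose j) * 2 ^ binomial_val r (?k j))"
      by (subst mult.commute) (simp add: multiplicity_power2_mult[OF nz])
    finally have "2 ^ binomial_val r N dvd int (2 ^ r choose j) * 2 ^ binomial_val r (?k j)"
      by (rule multiplicity_dvd')
    moreover have "f (?k j) = 2 ^ binomial_val r (?k j) * odd_part (f (?k j))"
      using val[of j] j by (intro has_binomial_valD(1)) auto
    ultimately show ?thesis
      by (metis (no_types, lifting) dvd_mult_div_cancel mult.assoc)
  qed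
  then have "(\<Sum>j\<in>?J. int (2 ^ r choose j) * f (?k j)) = 2 ^ binomial_val r N * (\<Sum>j\<in>?J.
      (int (2 ^ r choose j) * 2 ^ binomial_val r (?k j) div 2 ^ binomial_val r N) *
        odd_part (f (?k j)))"
    unfolding sum_distrib_left by (intro sum.cong refl) auto
  then show ?thesis
    using rec[unfolded dilation_recurrence_def, rule_format, of N] by (simp add: mult_ac)
qed

text \<open>Dividing the recurrence by the expected power of 2 leaves integer weights that do not depend
  on the sequence, so the parity of the quotient can be read off from the binomial coefficients.\<close>

lemma has_binomial_val_transfer:
  assumes f: "dilation_recurrence (2 ^ r) c f" "odd c" "\<And>k. k < 0 \<Longrightarrow> f k = 0" "f 0 = 1"
    and b: "dilation_recurrence (2 ^ r) 1 b" "\<And>k. has_binomial_val r b k"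
  shows "has_binomial_val r f N"
proof (induction "nat N" arbitrary: N rule: less_induct)
  case less
  consider "N < 0" | "N = 0" | "N > 0" by linarith
  then show ?case
  proof cases
    case 1
    then show ?thesis using f(3) by (simp add: has_binomial_val_def)
  next
    case 2
    then show ?thesis using f(4)
      by (simp add: has_binomial_val_def binomial_val_def residue_val_def block_val_def)
  next
    case 3
    let ?J = "{j. j \<le> 2 ^ r \<and> even (N - int j)}" and ?k = "\<lambda>j. (N - int j) div 2"
    let ?w = "\<lambda>j. int (2 ^ r choose j) * 2 ^ binomial_val r (?k j) div 2 ^ binomial_val r N"
    \<comment> \<open>For N > 0 halved indices are smaller, and \<open>nat\<close> sends negative
      ones to 0. At N = 0 the term j = 0 would refer back to N itself.\<close>
    have IH: "has_binomial_val r f (?k j)" for j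
      using 3 by (intro less) linarith
    \<comment> \<open>The parity of an odd part depends only on the sign of the index, so both
      weighted sums agree modulo 2; the one for b equals the odd number
      \<open>odd_part (b N)\<close>.\<close>
    have "even (\<Sum>j\<in>?J. ?w j * (odd_part (f (?k j)) - odd_part (b (?k j))))"
    proof (intro dvd_sum dvd_mult)
      fix j
      show "even (odd_part (f (?k j)) - odd_part (b (?k j)))"
        unfolding even_diff even_add
        using has_binomial_valD(2)[OF IH[of j]] has_binomial_valD(2)[OF b(2)[of "?k j"]] by blast
    qed
    then have par: "even ((\<Sum>j\<in>?J. ?w j * odd_part (f (?k j))) - (\<Sum>j\<in>?J. ?w j * odd_part (b (?k j))))"
      by (simp add: algebra_simps sum_subtractf)
    have "2 ^ binomial_val r N * odd_part (b N) =
        2 ^ binomial_val r N * (\<Sum>j\<in>?J. ?w j * odd_part (b (?k j)))"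
      using dilation_recurrence_odd_part[OF b(1), of N] b(2)[THEN has_binomial_valD(1), of N] b(2)
      by (simp split: if_splits)
    then have "odd_part (b N) = (\<Sum>j\<in>?J. ?w j * odd_part (b (?k j)))" by simp
    then have "odd (\<Sum>j\<in>?J. ?w j * odd_part (b (?k j)))"
      using has_binomial_valD(2)[OF b(2)[of N]] 3 by simp
    with par have "odd ((if even N then 1 else c) * (\<Sum>j\<in>?J. ?w j * odd_part (f (?k j))))"
      using f(2) by simp
    with dilation_recurrence_odd_part[OF f(1) IH]
    obtain o' where o': "odd o'" "f N = 2 ^ binomial_val r N * o'" by blast
    then have "o' \<noteq> 0" "multiplicity 2 o' = 0" by (auto simp: not_dvd_imp_multiplicity_0)
    then show ?thesis
      using o' 3 by (simp add: has_binomial_val_def multiplicity_power2_mult)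
  qed
qed

section \<open>Congruences and the finite state space\<close>

lemma sum_mult_mod_cong:
  fixes g h :: "'b \<Rightarrow> int"
  assumes "\<And>j. j \<in> A \<Longrightarrow> g j mod M = h j mod M"
  shows "(\<Sum>j\<in>A. w j * g j) mod M = (\<Sum>j\<in>A. w j * h j) mod M"
proof -
  have "M dvd (\<Sum>j\<in>A. w j * (g j - h j))"
    using assms by (intro dvd_sum dvd_mult) (simp add: mod_eq_dvd_iff)
  then show ?thesis by (simp add: mod_eq_dvd_iff right_diff_distrib sum_subtractf)
qed

lemma residue_val_mod_cong:
  assumes "k mod 2 ^ r = k' mod 2 ^ r"
  shows "residue_val r k = residue_val r k'"
  using assms multiplicity_cong_power2[OF assms] by (simp add: residue_val_def dvd_eq_mod_eq_0)

text \<open>Cancelling 2^e costs e <= r binary digits, hence the modulus 2^(s + r).\<close>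

lemma odd_part_mod_cong:
  assumes "a = 2 ^ e * odd_part a" "a' = 2 ^ e * odd_part a'" "e \<le> r"
    and "a mod 2 ^ (s + r) = a' mod 2 ^ (s + r)"
  shows "odd_part a mod 2 ^ s = odd_part a' mod 2 ^ s"
proof -
  have "2 ^ (s + e) dvd a - a'"
    using assms(3,4) by (metis add_le_cancel_left dvd_trans le_imp_power_dvd mod_eq_dvd_iff)
  also have "a - a' = 2 ^ e * (odd_part a - odd_part a')"
    using assms(1,2) by (simp add: right_diff_distrib)
  finally have "2 ^ s dvd odd_part a - odd_part a'"
    by (simp add: power_add mult.commute)
  then show ?thesis by (simp add: mod_eq_dvd_iff)
qed

text \<open>The window of offsets up to 2^r is closed under halving: from 2 * n + d - i the
  recurrence reaches n - l with 2 * l = i + j - d. The modulus 2^(r + 1) also records the parity of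
  the block number.\<close>

definition same_state :: "nat \<Rightarrow> nat \<Rightarrow> (int \<Rightarrow> int) \<Rightarrow> int \<Rightarrow> int \<Rightarrow> bool" where
  "same_state r s f n n' \<longleftrightarrow> n mod (2 * 2 ^ r) = n' mod (2 * 2 ^ r) \<and>
    (\<forall>j\<le>2 ^ r. f (n - int j) mod 2 ^ (s + r) = f (n' - int j) mod 2 ^ (s + r) \<and>
      odd_part (f (n - int j)) mod 2 ^ s = odd_part (f (n' - int j)) mod 2 ^ s)"

text \<open>If \<open>N mod 2 ^ (r + 1) \<le> 2 ^ r\<close>, the valuation at \<open>N\<close> is at most \<open>r\<close>, so reducing
  modulo \<open>2 ^ (s + r)\<close> determines the odd part; otherwise the unbounded parts of the valuations
  cancel in the weights, which therefore depend only on \<open>N mod 2 ^ (r + 1)\<close>.\<close>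

lemma same_state_step:
  assumes rec: "dilation_recurrence (2 ^ r) c f"
    and val: "\<And>k. has_binomial_val r f k"
    and same: "same_state r s f n n'" and d: "0 \<le> d" "d < 2"
  shows "same_state r s f (2 * n + d) (2 * n' + d)"
proof -
  let ?M = "2 ^ r :: int"
  have nn: "2 * ?M dvd n - n'"
    using same by (simp add: same_state_def mod_eq_dvd_iff)
  have main: "f N mod 2 ^ (s + r) = f N' mod 2 ^ (s + r) \<and>
      odd_part (f N) mod 2 ^ s = odd_part (f N') mod 2 ^ s"
    if i: "i \<le> 2 ^ r" and N: "N = 2 * n + d - int i" and N': "N' = 2 * n' + d - int i" for i N N'
  proof -
    let ?J = "{j. j \<le> 2 ^ r \<and> even (N - int j)}"
    let ?k = "\<lambda>j. (N - int j) div 2" and ?k' = "\<lambda>j. (N' - int j) div 2"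
    have NN: "N - N' = 2 * (n - n')" by (simp add: N N')
    then have par: "even N \<longleftrightarrow> even N'" by presburger
    then have J: "{j. j \<le> 2 ^ r \<and> even (N' - int j)} = ?J" by auto
    have Nmod: "N mod (2 * ?M) = N' mod (2 * ?M)"
      unfolding mod_eq_dvd_iff NN using nn by (rule dvd_mult)
    have shift: "\<exists>l\<le>2 ^ r. ?k j = n - int l \<and> ?k' j = n' - int l" if "j \<in> ?J" for j
    proof -
      have "even (N - int j)" using that by blast
      then have "even (int i + int j - d)" unfolding N by presburger
      then obtain t where t: "int i + int j - d = 2 * t" by blast
      have "int i \<le> ?M" "int j \<le> ?M"
        using i that of_nat_mono[of _ "2 ^ r", where ?'a = int] by auto
      \<comment> \<open>The even number i + j - d is at least -1, hence nonnegative.\<close>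
      with t d have "0 \<le> t" "t \<le> ?M" by linarith+
      then have "nat t \<le> 2 ^ r" "int (nat t) = t"
        by (simp_all add: nat_le_iff)
      moreover have "N - int j = 2 * (n - t)" "N' - int j = 2 * (n' - t)"
        using t by (simp_all add: N N')
      ultimately show ?thesis by (intro exI[of _ "nat t"]) simp
    qed
    have k: "f (?k j) mod 2 ^ (s + r) = f (?k' j) mod 2 ^ (s + r)"
      "odd_part (f (?k j)) mod 2 ^ s = odd_part (f (?k' j)) mod 2 ^ s"
      "?k j mod ?M = ?k' j mod ?M" if j: "j \<in> ?J" for j
    proof -
      obtain l where l: "l \<le> 2 ^ r" "?k j = n - int l" "?k' j = n' - int l"
        using shift[OF j] by blast
      show "f (?k j) mod 2 ^ (s + r) = f (?k' j) mod 2 ^ (s + r)"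
        "odd_part (f (?k j)) mod 2 ^ s = odd_part (f (?k' j)) mod 2 ^ s"
        using same l(1) unfolding l(2,3) same_state_def by auto
      show "?k j mod ?M = ?k' j mod ?M"
        unfolding l(2,3) using nn by (simp add: mod_eq_dvd_iff dvd_mult_right)
    qed
    let ?\<sigma> = "if even N then 1 else c"
    have sum: "(\<Sum>j\<in>?J. int (2 ^ r choose j) * f (?k j)) mod 2 ^ (s + r) =
        (\<Sum>j\<in>?J. int (2 ^ r choose j) * f (?k' j)) mod 2 ^ (s + r)"
      using k(1) by (rule sum_mult_mod_cong)
    have f_rec: "f N = ?\<sigma> * (\<Sum>j\<in>?J. int (2 ^ r choose j) * f (?k j))"
      "f N' = ?\<sigma> * (\<Sum>j\<in>?J. int (2 ^ r choose j) * f (?k' j))"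
      using rec[unfolded dilation_recurrence_def, rule_format, of N]
        rec[unfolded dilation_recurrence_def, rule_format, of N'] unfolding par J by blast+
    have fN: "f N mod 2 ^ (s + r) = f N' mod 2 ^ (s + r)"
      unfolding f_rec by (rule mod_mult_cong[OF refl sum])
    have \<alpha>: "residue_val r N = residue_val r N'"
      using Nmod by (intro residue_val_mod_cong) (metis mod_mod_cancel dvd_triv_right)
    have "odd_part (f N) mod 2 ^ s = odd_part (f N') mod 2 ^ s"
    proof (cases "N mod (2 * ?M) \<le> ?M")
      case True
      then have "binomial_val r N = residue_val r N" "binomial_val r N' = residue_val r N"
        using Nmod \<alpha> by (simp_all add: binomial_val_def block_val_eq_0)
      then show ?thesis
        using has_binomial_valD(1)[OF val[of N]] has_binomial_valD(1)[OF val[of N']] fN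
        by (intro odd_part_mod_cong[of _ "residue_val r N" _ r]) (auto simp: residue_val_def)
    next
      case False
      \<comment> \<open>The \<open>Suc\<close> is the growth of \<open>block_val\<close> from the
        halved index to N; the common factor \<open>2 ^ block_val\<close> has been
        cancelled.\<close>
      let ?w = "\<lambda>j. int (2 ^ r choose j) * 2 ^ residue_val r (?k j) div 2 ^ Suc (residue_val r N)"
      \<comment> \<open>A general X lets N and N' share the same weights.\<close>
      have odd_rec: "odd_part (f X) = ?\<sigma> * (\<Sum>j\<in>?J. ?w j * odd_part (f ((X - int j) div 2)))"
        if X: "X mod (2 * ?M) = N mod (2 * ?M)" "even X \<longleftrightarrow> even N"
          "{j. j \<le> 2 ^ r \<and> even (X - int j)} = ?J" "residue_val r X = residue_val r N"
          "\<And>j. j \<in> ?J \<Longrightarrow> residue_val r ((X - int j) div 2) = residue_val r (?k j)" for X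
      proof -
        let ?x = "\<lambda>j. (X - int j) div 2"
        have weights: "(int (2 ^ r choose j) * 2 ^ binomial_val r (?x j) div 2 ^ binomial_val r X) *
            odd_part (f (?x j)) = ?w j * odd_part (f (?x j))" if j: "j \<in> ?J" for j
        proof (cases "?x j < 0")
          case True
          then show ?thesis using val[of "?x j"] by (simp add: has_binomial_val_def odd_part_def)
        next
          case nonneg: False
          have jM: "int j \<le> ?M" using j of_nat_mono[of j "2 ^ r", where ?'a = int] by simp
          have "even (X - int j)" using j X(3) by blast
          then have Xj: "2 * ?x j + int j = X" by simp
          have "block_val r X = Suc (block_val r (?x j))"
            using block_val_halving(3)[of r "?x j" "int j"] False X(1) nonneg jM
            unfolding Xj by simp
          then have "int (2 ^ r choose j) * 2 ^ binomial_val r (?x j) div 2 ^ binomial_val r X =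
              (int (2 ^ r choose j) * 2 ^ residue_val r (?k j)) * 2 ^ block_val r (?x j) div
              (2 ^ Suc (residue_val r N) * 2 ^ block_val r (?x j))"
            using X(4) X(5)[OF j] by (simp add: binomial_val_def power_add mult_ac)
          then show ?thesis by (simp only: div_mult_mult2 power_not_zero) simp
        qed
        have sum: "(\<Sum>j\<in>?J. (int (2 ^ r choose j) * 2 ^ binomial_val r (?x j) div
            2 ^ binomial_val r X) * odd_part (f (?x j))) = (\<Sum>j\<in>?J. ?w j * odd_part (f (?x j)))"
          by (rule sum.cong[OF refl weights])
        have "f X = 2 ^ binomial_val r X * (?\<sigma> * (\<Sum>j\<in>?J. ?w j * odd_part (f (?x j))))"
          using dilation_recurrence_odd_part[OF rec val, of X]
          unfolding X(2,3) sum .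
        with has_binomial_valD(1)[OF val, of X]
        have "2 ^ binomial_val r X * odd_part (f X) =
            2 ^ binomial_val r X * (?\<sigma> * (\<Sum>j\<in>?J. ?w j * odd_part (f (?x j))))"
          by (rule trans[OF sym])
        then show ?thesis
          unfolding mult_cancel_left by simp
      qed
      have oN: "odd_part (f N) = ?\<sigma> * (\<Sum>j\<in>?J. ?w j * odd_part (f (?k j)))"
        by (rule odd_rec) auto
      have oN': "odd_part (f N') = ?\<sigma> * (\<Sum>j\<in>?J. ?w j * odd_part (f (?k' j)))"
        using Nmod par J \<alpha> k(3) by (intro odd_rec) (auto intro!: residue_val_mod_cong)
      have sum: "(\<Sum>j\<in>?J. ?w j * odd_part (f (?k j))) mod 2 ^ s =
          (\<Sum>j\<in>?J. ?w j * odd_part (f (?k' j))) mod 2 ^ s"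
        using k(2) by (rule sum_mult_mod_cong)
      show ?thesis unfolding oN oN' by (rule mod_mult_cong[OF refl sum])
    qed
    with fN show ?thesis by blast
  qed
  have "(2 * n + d) mod (2 * ?M) = (2 * n' + d) mod (2 * ?M)"
    using dvd_mult[OF nn, of 2] by (simp add: mod_eq_dvd_iff right_diff_distrib)
  with main show ?thesis unfolding same_state_def by blast
qed

section \<open>Construction of the automaton\<close>

text \<open>The values of g, coded as naturals, are the states. A transition passes through an
  arbitrary representative of the state, and \<open>step\<close> makes the result independent of
  that choice.\<close>

lemma two_automatic_if_finite_states:
  fixes g :: "nat \<Rightarrow> 'b"
  assumes fin: "finite (range g)"
    and step: "\<And>m n d. g m = g n \<Longrightarrow> d < 2 \<Longrightarrow> g (2 * m + d) = g (2 * n + d)"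
    and out: "\<And>m n. g m = g n \<Longrightarrow> a m = a n"
  shows "two_automatic a"
proof -
  obtain h :: "'b \<Rightarrow> nat" where h: "inj_on h (range g)"
    using finite_imp_inj_to_nat_seg[OF fin] by blast
  define rep where "rep q = (SOME n. h (g n) = q)" for q
  have "h (g (rep (h (g n)))) = h (g n)" for n
    unfolding rep_def by (rule someI[of _ n]) simp
  then have rep: "g (rep (h (g n))) = g n" for n
    using h by (auto dest: inj_onD)
  define \<delta> where "\<delta> q d = h (g (2 * rep q + d))" for q d
  have run: "foldl \<delta> (h (g 0)) (binary_digits n) = h (g n)" for n
    by (rule foldl_binary_digits) (auto simp: \<delta>_def intro!: arg_cong[of _ _ h] step rep[symmetric])
  have "a (rep (h (g n))) = a n" for n
    by (rule out[OF rep])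
  then show ?thesis
    unfolding two_automatic_def
    by (intro exI[of _ "h ` range g"] exI[of _ "h (g 0)"] exI[of _ \<delta>] exI[of _ "\<lambda>q. a (rep q)"])
      (use fin in \<open>auto simp: run \<delta>_def\<close>)
qed

lemma two_automatic_odd_part:
  assumes rec: "dilation_recurrence (2 ^ r) c f"
    and val: "\<And>k. has_binomial_val r f k"
  shows "two_automatic (\<lambda>n. odd_part (f (int n)) mod 2 ^ s)"
proof -
  \<comment> \<open>The data compared by \<open>same_state\<close>, listed as residues so that only
    finitely many values occur.\<close>
  define g where "g n = (int n mod (2 * 2 ^ r),
    map (\<lambda>j. f (int n - int j) mod 2 ^ (s + r)) [0..<Suc (2 ^ r)],
    map (\<lambda>j. odd_part (f (int n - int j)) mod 2 ^ s) [0..<Suc (2 ^ r)])" for n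
  have g_eq: "g n = g n' \<longleftrightarrow> same_state r s f (int n) (int n')" for n n'
    unfolding g_def same_state_def prod.inject map_eq_conv set_upt by (auto simp: less_Suc_eq_le)
  let ?L = "\<lambda>e. {xs :: int list. set xs \<subseteq> {0..<2 ^ e} \<and> length xs = Suc (2 ^ r)}"
  have "range g \<subseteq> {0..<2 * 2 ^ r} \<times> ?L (s + r) \<times> ?L s"
    by (auto simp: g_def)
  then have "finite (range g)"
    by (rule finite_subset) (intro finite_cartesian_product finite_lists_length_eq; simp)
  then show ?thesis
  proof (rule two_automatic_if_finite_states)
    show "g (2 * m + d) = g (2 * n + d)" if "g m = g n" "d < 2" for m n d
      using same_state_step[OF rec val, of s "int m" "int n" "int d"] that by (simp add: g_eq)
    show "odd_part (f (int m)) mod 2 ^ s = odd_part (f (int n)) mod 2 ^ s" if "g m = g n" for m n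
      using that unfolding g_eq same_state_def by (auto dest: spec[of _ 0])
  qed
qed

theorem theorem1p1:
  fixes r m :: nat
  assumes "r \<ge> 1" and "m = 2 ^ r"
  shows "(\<forall>n. nu2 (thue_morse_coeff m n) = nu2 (int ((n + m - 1) choose (m - 1)))) \<and>
         (\<forall>s\<ge>1. two_automatic (\<lambda>n. odd_part (thue_morse_coeff m n) mod 2 ^ s))"
proof -
  define f where "f = int_coeff (thue_morse_fps ^ m)"
  \<comment> \<open>The comparison sequence: its valuations are known from
    \<open>multiplicity_binomial\<close> and are transferred to f.\<close>
  define b where "b = int_coeff (Abs_fps (\<lambda>_. 1) ^ m)"
  have b_nth: "b (int n) = int ((n + (2 ^ r - 1)) choose (2 ^ r - 1))" for n
    using geometric_fps_power_nth[of "2 ^ r - 1" n] by (simp add: b_def int_coeff_def assms(2))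
  have b: "has_binomial_val r b k" for k
  proof (cases "k < 0")
    case True
    then show ?thesis by (simp add: has_binomial_val_def b_def int_coeff_def)
  next
    case False
    then obtain n where "k = int n" by (metis nonneg_int_cases not_less)
    then show ?thesis
      using multiplicity_binomial[OF assms(1), of n]
      by (simp add: has_binomial_val_def b_nth binomial_eq_0_iff)
  qed
  have rec_b: "dilation_recurrence (2 ^ r) 1 b"
    unfolding b_def assms(2)
    by (rule dilation_recurrence_power) (use geometric_fps_dilation in simp_all)
  have rec_f: "dilation_recurrence (2 ^ r) (- 1) f"
    unfolding f_def assms(2)
    by (rule dilation_recurrence_power) (use thue_morse_fps_dilation in \<open>simp_all flip: fps_const_neg\<close>)
  have "fps_nth thue_morse_fps 0 = 1"
    by (simp add: thue_morse_fps_nth[of 0 0])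
  then have f: "has_binomial_val r f k" for k
    using rec_f rec_b b
    by (intro has_binomial_val_transfer[of r "- 1" f b])
      (auto simp: f_def int_coeff_def fps_nth_power_0)
  have f_nth: "thue_morse_coeff m n = f (int n)" for n
    by (simp add: thue_morse_coeff_def f_def int_coeff_def)
  have "nu2 (f (int n)) = nu2 (b (int n))" for n
    using f[of "int n"] b[of "int n"] by (simp add: has_binomial_val_def nu2_def)
  moreover have "int ((n + m - 1) choose (m - 1)) = b (int n)" for n
    using b_nth[of n] by (simp add: assms(2))
  ultimately show ?thesis
    using two_automatic_odd_part[OF rec_f f] by (simp only: f_nth) blast
qed

end
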